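(* Let $L<M<H$ be reals and consider the $1$-item procurement auction with two agents over the three-values domain $\Theta=\{L,M,H\}^2$. The $\lambda_M$-linear mechanism is the only bribeproof mechanism: the $\lambda_M$-linear mechanism that selects an agent with smallest reported type (ties in favor of agent $1$) is bribeproof, and for every bribeproof mechanism $(A,p)$ whose algorithm $A$ always selects an agent with smallest reported type (with arbitrary tie-breaking) there are constants $f_1,f_2\in\mathbb{R}$ such that $p_i(\theta)=f_i+M\cdot A_i(\theta)$ for all $\theta\in\Theta$ and $i\in\{1,2\}$.
   Context: In the $1$-item procurement auction with two agents, the feasible allocations are $(1,0)$ and $(0,1)$ (exactly one agent is selected). Agent $i$ has private type $\theta_i\in\Theta_i$ and her cost for allocation $a$ is $a_i\theta_i$. $\Theta=\Theta_1\times\Theta_2$. A mechanism is a pair $(A,p)$ with $A$ mapping each $\theta\in\Theta$ to a feasible allocation and $p:\Theta\to\mathbb{R}^2$ giving payments to the agents; the algorithm selects an agent of minimum reported type. A $\lambda$-linear mechanism has payments $p_i(\theta)=A_i(\theta)(\lambda L+(1-\lambda)H)+f_i$ with real constants $f_i$. Here $\lambda_M:=\frac{H-M}{H-L}$, so that $\lambda_M L+(1-\lambda_M)H=M$. $(A,p)$ is bribeproof if for all $\theta\in\Theta$, all agents $i,j$ and all $\hat\theta_i\in\Theta_i$, with $\hat\theta$ denoting $\theta$ with its $i$-th entry replaced by $\hat\theta_i$: if $i\neq j$, $p_i(\theta)-A_i(\theta)\theta_i+p_j(\theta)-A_j(\theta)\theta_j\ge p_i(\hat\theta)-A_i(\hat\theta)\theta_i+p_j(\hat\theta)-A_j(\hat\theta)\theta_j$;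 and, for $i=j$, $p_i(\theta)-A_i(\theta)\theta_i\ge p_i(\hat\theta)-A_i(\hat\theta)\theta_i$. *)

theory Defs
  imports Complex_Main "HOL-Library.FuncSet" "HOL-Library.Indicator_Function"
    "HOL-Library.Numeral_Type"
begin

text \<open>
  Agents are the elements of the index type \<open>'n\<close>; a type profile, an allocation and a
  payment vector are all functions \<open>'n \<Rightarrow> real\<close>.  Two agents are modelled by the
  two-element type \<open>2\<close>, whose distinct elements are written \<open>1\<close> and \<open>2\<close>.

  Algorithms and payment rules are total functions, but they are only constrained on, and
  only evaluated at, profiles in the domain \<^term>\<open>profiles D\<close>.
\<close>

definition profiles :: "('n \<Rightarrow> real set) \<Rightarrow> ('n \<Rightarrow> real) set" where
  "profiles D = (\<Pi> i\<in>UNIV. D i)"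

definition one_item_allocations :: "('n \<Rightarrow> real) set" where
  "one_item_allocations = {a. \<exists>i. a = indicator {i}}"

definition mechanism ::
  "('n \<Rightarrow> real set) \<Rightarrow> (('n \<Rightarrow> real) \<Rightarrow> 'n \<Rightarrow> real) \<Rightarrow> (('n \<Rightarrow> real) \<Rightarrow> 'n \<Rightarrow> real) \<Rightarrow> bool"
where
  "mechanism D A p \<longleftrightarrow> (\<forall>\<theta>\<in>profiles D. A \<theta> \<in> one_item_allocations)"

text \<open>The payment rule is unconstrained by \<^const>\<open>mechanism\<close>: it is any real-valued rule.\<close>

definition selects_min ::
  "('n \<Rightarrow> real set) \<Rightarrow> (('n \<Rightarrow> real) \<Rightarrow> 'n \<Rightarrow> real) \<Rightarrow> bool"
where
  "selects_min D A \<longleftrightarrow> (\<forall>\<theta>\<in>profiles D. \<forall>i. A \<theta> i = 1 \<longrightarrow> (\<forall>j. \<theta> i \<le> \<theta> j))"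

definition bribeproof ::
  "('n \<Rightarrow> real set) \<Rightarrow> (('n \<Rightarrow> real) \<Rightarrow> 'n \<Rightarrow> real) \<Rightarrow> (('n \<Rightarrow> real) \<Rightarrow> 'n \<Rightarrow> real) \<Rightarrow> bool"
where
  "bribeproof D A p \<longleftrightarrow>
    (\<forall>\<theta>\<in>profiles D. \<forall>i j. \<forall>x\<in>D i.
      (i \<noteq> j \<longrightarrow>
        p \<theta> i - A \<theta> i * \<theta> i + p \<theta> j - A \<theta> j * \<theta> j
          \<ge> p (\<theta>(i := x)) i - A (\<theta>(i := x)) i * \<theta> i
            + p (\<theta>(i := x)) j - A (\<theta>(i := x)) j * \<theta> j) \<and>
      (i = j \<longrightarrow>
        p \<theta> i - A \<theta> i * \<theta> i \<ge> p (\<theta>(i := x)) i - A (\<theta>(i := x)) i * \<theta> i))"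

definition linear_payment ::
  "real \<Rightarrow> real \<Rightarrow> real \<Rightarrow> (('n \<Rightarrow> real) \<Rightarrow> 'n \<Rightarrow> real) \<Rightarrow> ('n \<Rightarrow> real) \<Rightarrow> ('n \<Rightarrow> real) \<Rightarrow> 'n \<Rightarrow> real"
where
  "linear_payment L H l A f \<theta> i = A \<theta> i * (l * L + (1 - l) * H) + f i"

definition lambda_M :: "real \<Rightarrow> real \<Rightarrow> real \<Rightarrow> real" where
  "lambda_M L M H = (H - M) / (H - L)"

definition min_alg :: "(2 \<Rightarrow> real) \<Rightarrow> 2 \<Rightarrow> real" where
  "min_alg \<theta> = (if \<theta> 1 \<le> \<theta> 2 then indicator {1} else indicator {2})"

end

theory Submission imports Defs "HOL-Analysis.Cartesian_Space" begin

text \<open>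
  If a unilateral deviation leaves the allocation unchanged, bribeproofness in both directions
  leaves all payments unchanged.  The profiles at which a given agent wins are connected by such
  deviations, so the payments depend only on the winner.  If \<open>i\<close> wins at \<open>(M, M)\<close>, truthfulness there
  shows that winning raises the payment of \<open>i\<close> by at least \<open>M\<close> and that of the other agent \<open>j\<close> by at
  most \<open>M\<close>.  If \<open>j\<close> wins one of the other two ties, bribeproofness at that tie gives the reverse
  comparison of the two increments; if \<open>i\<close> wins both of them, truthfulness at \<open>(L, L)\<close> bounds the
  first increment above by \<open>M\<close> and truthfulness at \<open>(H, H)\<close> bounds the second below by \<open>M\<close>.
\<close>

lemma mem_profiles_iff: "\<theta> \<in> profiles D \<longleftrightarrow> (\<forall>i. \<theta> i \<in> D i)"
  by (auto simp: profiles_def)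

lemma two_exhaust: "i \<noteq> j \<Longrightarrow> k = i \<or> k = j" for i j k :: 2
  by (metis exhaust_2)

lemma exists_another: "\<exists>j. i \<noteq> j" for i :: 2
  by (metis zero_neq_one)

section \<open>Constraints imposed by a single deviation\<close>

lemma bribeproof_single:
  assumes "bribeproof D A p" "\<theta> \<in> profiles D" "x \<in> D i"
  shows "p \<theta> i - A \<theta> i * \<theta> i \<ge> p (\<theta>(i := x)) i - A (\<theta>(i := x)) i * \<theta> i"
  using assms unfolding bribeproof_def by blast

lemma bribeproof_pair:
  assumes "bribeproof D A p" "\<theta> \<in> profiles D" "x \<in> D i" "i \<noteq> j"
  shows "p \<theta> i - A \<theta> i * \<theta> i + p \<theta> j - A \<theta> j * \<theta> j
      \<ge> p (\<theta>(i := x)) i - A (\<theta>(i := x)) i * \<theta> i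
        + p (\<theta>(i := x)) j - A (\<theta>(i := x)) j * \<theta> j"
  using assms unfolding bribeproof_def by blast

text \<open>All costs cancel. The single-agent condition in both directions fixes the payment of the
  deviator, and then the pair condition with any \<open>k\<close> fixes that of
  \<open>k\<close>.\<close>

lemma bribeproof_same_allocation:
  assumes bp: "bribeproof D A p" and \<theta>: "\<theta> \<in> profiles D" and x: "x \<in> D i"
    and same: "A (\<theta>(i := x)) = A \<theta>"
  shows "p (\<theta>(i := x)) = p \<theta>"
proof
  fix k
  have \<theta>': "\<theta>(i := x) \<in> profiles D" "\<theta> i \<in> D i"
    using \<theta> x by (auto simp: mem_profiles_iff)
  have own: "p (\<theta>(i := x)) i = p \<theta> i"
    using bribeproof_single[OF bp \<theta> x] bribeproof_single[OF bp \<theta>'] same by simp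
  show "p (\<theta>(i := x)) k = p \<theta> k"
  proof (cases "k = i")
    case False
    then show ?thesis
      using bribeproof_pair[where j = k, OF bp \<theta> x] bribeproof_pair[where j = k, OF bp \<theta>']
        own same by simp
  qed (simp add: own)
qed

text \<open>The two differences are what \<open>i\<close> and \<open>j\<close> are paid extra for
  winning. The lower bounds come from \<open>i\<close> having true cost \<open>\<theta> i\<close>,
  the upper ones from the reverse deviation, where the true cost is \<open>x\<close>.\<close>

lemma bribeproof_winner_change:
  fixes i j :: 'n
  assumes bp: "bribeproof D A p" and \<theta>: "\<theta> \<in> profiles D" and x: "x \<in> D i" and ij: "i \<noteq> j"
    and win: "A \<theta> = indicator {i}" "A (\<theta>(i := x)) = indicator {j}"
  shows "\<theta> i \<le> p \<theta> i - p (\<theta>(i := x)) i" "p \<theta> i - p (\<theta>(i := x)) i \<le> x"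
    and "\<theta> i - \<theta> j \<le> (p \<theta> i - p (\<theta>(i := x)) i) - (p (\<theta>(i := x)) j - p \<theta> j)"
    and "(p \<theta> i - p (\<theta>(i := x)) i) - (p (\<theta>(i := x)) j - p \<theta> j) \<le> x - \<theta> j"
proof -
  have \<theta>': "\<theta>(i := x) \<in> profiles D" "\<theta> i \<in> D i"
    using \<theta> x by (auto simp: mem_profiles_iff)
  show "\<theta> i \<le> p \<theta> i - p (\<theta>(i := x)) i" "p \<theta> i - p (\<theta>(i := x)) i \<le> x"
    using bribeproof_single[OF bp \<theta> x] bribeproof_single[OF bp \<theta>'] ij by (simp_all add: win)
  show "\<theta> i - \<theta> j \<le> (p \<theta> i - p (\<theta>(i := x)) i) - (p (\<theta>(i := x)) j - p \<theta> j)"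
    using bribeproof_pair[OF bp \<theta> x ij] ij by (simp add: win)
  show "(p \<theta> i - p (\<theta>(i := x)) i) - (p (\<theta>(i := x)) j - p \<theta> j) \<le> x - \<theta> j"
    using bribeproof_pair[OF bp \<theta>' ij] ij by (simp add: win)
qed

text \<open>With two agents this covers every profile without naming agents 1 and 2, so arguments
  can treat \<open>i\<close> and \<open>j\<close> symmetrically.\<close>

definition profile_of :: "'n \<Rightarrow> real \<Rightarrow> real \<Rightarrow> 'n \<Rightarrow> real" where
  "profile_of i x y k = (if k = i then x else y)"

lemma profile_of_same [simp]: "profile_of i x y i = x"
  by (simp add: profile_of_def)

lemma profile_of_other [simp]: "k \<noteq> i \<Longrightarrow> profile_of i x y k = y"
  by (simp add: profile_of_def)

lemma profile_of_upd [simp]: "(profile_of i x y)(i := z) = profile_of i z y"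
  by (auto simp: profile_of_def)

lemma profile_of_commute: "i \<noteq> j \<Longrightarrow> profile_of j x y = profile_of i y x" for i j :: 2
  using two_exhaust by (fastforce simp: profile_of_def)

lemma profile_of_upd_other: "i \<noteq> j \<Longrightarrow> (profile_of i x y)(j := z) = profile_of i x z" for i j :: 2
  by (metis profile_of_commute profile_of_upd)

lemma eq_profile_of: "i \<noteq> j \<Longrightarrow> \<theta> = profile_of i (\<theta> i) (\<theta> j)" for i j :: 2
  using two_exhaust by (fastforce simp: profile_of_def)

lemma profile_of_mem_profiles: "x \<in> S \<Longrightarrow> y \<in> S \<Longrightarrow> profile_of i x y \<in> profiles (\<lambda>_. S)"
  by (auto simp: mem_profiles_iff profile_of_def)

section \<open>Uniqueness of the payments\<close>

locale three_value_auction =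
  fixes L M H :: real and D :: "2 \<Rightarrow> real set" and A p :: "(2 \<Rightarrow> real) \<Rightarrow> 2 \<Rightarrow> real"
  assumes LM: "L < M" and MH: "M < H" and D: "D = (\<lambda>_. {L, M, H})"
    and mech: "mechanism D A p" and sel: "selects_min D A" and bp: "bribeproof D A p"
begin

lemma prof: "x \<in> {L, M, H} \<Longrightarrow> y \<in> {L, M, H} \<Longrightarrow> profile_of i x y \<in> profiles D"
  unfolding D by (rule profile_of_mem_profiles)

lemma winner:
  assumes "\<theta> \<in> profiles D" "i \<noteq> j"
  shows "A \<theta> = indicator {i} \<or> A \<theta> = indicator {j}"
proof -
  obtain k where "A \<theta> = indicator {k}"
    using mech assms(1) unfolding mechanism_def one_item_allocations_def by auto
  then show ?thesis
    using two_exhaust[OF assms(2), of k] by auto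
qed

lemma winner_le: "\<theta> \<in> profiles D \<Longrightarrow> A \<theta> = indicator {i} \<Longrightarrow> \<theta> i \<le> \<theta> j"
  using sel unfolding selects_min_def by simp

lemma winner_less:
  assumes "\<theta> \<in> profiles D" "\<theta> i < \<theta> j"
  shows "A \<theta> = indicator {i}"
  using winner[OF assms(1), of i j] winner_le[OF assms(1), of j i] assms(2) by fastforce

text \<open>First the loser's report is raised to \<open>H\<close>, then the winner's is lowered to
  \<open>L\<close>; \<open>i\<close> stays selected throughout.\<close>

lemma payment_winner:
  assumes \<theta>: "\<theta> \<in> profiles D" and win: "A \<theta> = indicator {i}"
  shows "p \<theta> = p (profile_of i L H)"
proof -
  obtain j where ij: "i \<noteq> j"
    using exists_another by blast
  define x y where "x = \<theta> i" and "y = \<theta> j"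
  have \<theta>_eq: "\<theta> = profile_of i x y"
    unfolding x_def y_def using ij by (rule eq_profile_of)
  have xy: "x \<in> {L, M, H}" "y \<in> {L, M, H}" "x \<le> y"
    using \<theta> winner_le[OF \<theta> win] by (auto simp: x_def y_def mem_profiles_iff D)
  have LH: "A (profile_of i L H) = indicator {i}"
    using winner_less[of "profile_of i L H" i j] ij LM MH prof by simp
  have to_L: "p (profile_of i L H) = p (profile_of i x H)"
    if "A (profile_of i x H) = indicator {i}"
    using bribeproof_same_allocation[OF bp, of "profile_of i x H" L i] LH that xy prof
    by (simp add: D)
  show ?thesis
  \<comment> \<open>A winner reporting \<open>H\<close> faces a loser reporting \<open>H\<close>, so
    only the second move remains. If \<open>x < H\<close>, the intermediate profile is no tie and
    \<open>i\<close> wins it.\<close>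
  proof (cases "x = H")
    case True
    with xy LM MH have "y = H" by auto
    then show ?thesis
      using to_L win \<theta>_eq by simp
  next
    case False
    with xy LM MH have "x < H" by auto
    then have xH: "A (profile_of i x H) = indicator {i}"
      using winner_less[of "profile_of i x H" i j] ij xy prof by simp
    then have "p (profile_of i x H) = p \<theta>"
      using bribeproof_same_allocation[OF bp \<theta>, of H j] win ij
      by (simp add: D \<theta>_eq profile_of_upd_other)
    then show ?thesis
      using to_L xH by simp
  qed
qed

lemma payment_increment_eq:
  assumes ij: "i \<noteq> j" and tie: "A (profile_of i M M) = indicator {i}"
  shows "p (profile_of i L H) i - p (profile_of j L H) i = M"
    and "p (profile_of j L H) j - p (profile_of i L H) j = M"
proof -
  \<comment> \<open>These are the payment vectors when \<open>i\<close> and \<open>j\<close> win, so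
    \<open>a i - b i\<close> and \<open>b j - a j\<close> are the increments for winning.\<close>
  define a b where "a = p (profile_of i L H)" and "b = p (profile_of j L H)"
  have pi: "p (profile_of i x y) = a"
    if "A (profile_of i x y) = indicator {i}" "x \<in> {L, M, H}" "y \<in> {L, M, H}" for x y
    using payment_winner that prof by (simp add: a_def)
  have pj: "p (profile_of i x y) = b"
    if "A (profile_of i x y) = indicator {j}" "x \<in> {L, M, H}" "y \<in> {L, M, H}" for x y
    using payment_winner that prof by (simp add: b_def)
  have wi: "A (profile_of i x y) = indicator {i}"
    if "x < y" "x \<in> {L, M, H}" "y \<in> {L, M, H}" for x y
    using winner_less[of "profile_of i x y" i j] ij that prof by simp
  have wj: "A (profile_of i x y) = indicator {j}"
    if "y < x" "x \<in> {L, M, H}" "y \<in> {L, M, H}" for x y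
    using winner_less[of "profile_of i x y" j i] ij that prof by simp
  have dev_i: "x \<le> a i - b i \<and> a i - b i \<le> z
      \<and> x - y \<le> (a i - b i) - (b j - a j) \<and> (a i - b i) - (b j - a j) \<le> z - y"
    if "A (profile_of i x y) = indicator {i}" "A (profile_of i z y) = indicator {j}"
      "x \<in> {L, M, H}" "y \<in> {L, M, H}" "z \<in> {L, M, H}" for x y z
    using bribeproof_winner_change[OF bp, of "profile_of i x y" z i j]
      that ij prof pi pj by (simp add: D)
  have dev_j: "y \<le> b j - a j \<and> b j - a j \<le> z
      \<and> y - x \<le> (b j - a j) - (a i - b i) \<and> (b j - a j) - (a i - b i) \<le> z - x"
    if "A (profile_of i x y) = indicator {j}" "A (profile_of i x z) = indicator {i}"
      "x \<in> {L, M, H}" "y \<in> {L, M, H}" "z \<in> {L, M, H}" for x y z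
    using bribeproof_winner_change[OF bp, of "profile_of i x y" z j i]
      that ij prof pi pj by (simp add: D profile_of_upd_other)
  \<comment> \<open>At the tie, with true costs \<open>M\<close>, agent \<open>i\<close> must not
    prefer to lose by reporting \<open>H\<close>, nor, for the next bound, \<open>j\<close> to win
    by reporting \<open>L\<close>.\<close>
  have lower: "M \<le> a i - b i"
    using dev_i[OF tie wj[of M H]] LM MH by simp
  have upper: "b j - a j \<le> M"
    using dev_j[OF wj[of L M] tie] LM MH by simp
  have "a i - b i = M \<and> b j - a j = M"
  proof (cases "A (profile_of i L L) = indicator {j} \<or> A (profile_of i H H) = indicator {j}")
    case True
    \<comment> \<open>At a tie the costs of the two agents cancel in the pair condition, leaving
      only the increments.\<close>
    then have "a i - b i \<le> b j - a j"
    proof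
      assume "A (profile_of i L L) = indicator {j}"
      then show ?thesis
        using dev_j[OF _ wi[of L M]] LM MH by fastforce
    next
      assume "A (profile_of i H H) = indicator {j}"
      then show ?thesis
        using dev_i[OF wi[of M H]] LM MH by fastforce
    qed
    then show ?thesis
      using lower upper by linarith
  next
    case False
    then have LL: "A (profile_of i L L) = indicator {i}" and HH: "A (profile_of i H H) = indicator {i}"
      using winner[OF _ ij] prof by auto
    \<comment> \<open>With true costs \<open>M\<close> for \<open>i\<close> and \<open>L\<close> for
      \<open>j\<close>, agent \<open>i\<close> must not gain by winning the tie at \<open>L\<close>.
      Below, \<open>j\<close> with cost \<open>M\<close> against \<open>H\<close> must not gain by
      losing the tie at \<open>H\<close>.\<close>
    have "a i - b i \<le> M"
      using dev_i[OF LL wj[of L M]] LM MH by simp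
    moreover have "M \<le> b j - a j"
      using dev_j[OF wj[of M H] HH] LM MH by simp
    ultimately show ?thesis
      using lower upper by linarith
  qed
  then show "p (profile_of i L H) i - p (profile_of j L H) i = M"
    and "p (profile_of j L H) j - p (profile_of i L H) j = M"
    by (simp_all add: a_def b_def)
qed

lemma payment_linear: "\<exists>f. \<forall>\<theta>\<in>profiles D. \<forall>k. p \<theta> k = f k + M * A \<theta> k"
proof -
  have "(\<lambda>_. M) \<in> profiles D"
    by (simp add: mem_profiles_iff D)
  then obtain i where "A (\<lambda>_. M) = indicator {i}"
    using mech unfolding mechanism_def one_item_allocations_def by blast
  moreover have "profile_of i M M = (\<lambda>_. M)"
    by (auto simp: profile_of_def)
  ultimately have tie: "A (profile_of i M M) = indicator {i}"
    by simp
  obtain j where ij: "i \<noteq> j"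
    using exists_another by blast
  \<comment> \<open>The constant of an agent is its payment when the other one wins.\<close>
  define f where "f k = (if k = i then p (profile_of j L H) i else p (profile_of i L H) j)" for k
  have "p \<theta> k = f k + M * A \<theta> k" if \<theta>: "\<theta> \<in> profiles D" for \<theta> k
    using winner[OF \<theta> ij] payment_winner[OF \<theta>] payment_increment_eq[OF ij tie]
      two_exhaust[OF ij, of k] ij by (auto simp: f_def)
  then show ?thesis
    by blast
qed

end

section \<open>Bribeproofness of the linear mechanism\<close>

lemma mechanism_min_alg: "mechanism D min_alg p"
  by (auto simp: mechanism_def one_item_allocations_def min_alg_def)

lemma selects_min_min_alg: "selects_min D min_alg"
  unfolding selects_min_def
proof (intro ballI allI impI)
  fix \<theta> i j assume "min_alg \<theta> i = 1"
  then show "\<theta> i \<le> \<theta> j"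
    using exhaust_2[of i] exhaust_2[of j] by (auto simp: min_alg_def split: if_splits)
qed

lemma lambda_M_combination:
  assumes "L < H"
  shows "lambda_M L M H * L + (1 - lambda_M L M H) * H = M"
proof -
  have "lambda_M L M H * L + (1 - lambda_M L M H) * H = H - lambda_M L M H * (H - L)"
    by (simp add: algebra_simps)
  then show ?thesis
    using assms by (simp add: lambda_M_def)
qed

text \<open>Joint utility is a constant minus the selected agent's cost, which truth minimizes.
  Alone, an agent of cost \<open>L\<close> wants to win, one of cost \<open>H\<close> wants to lose,
  and one of cost \<open>M\<close> is indifferent; reporting \<open>L\<close> is best for winning
  and \<open>H\<close> for losing.\<close>

lemma bribeproof_min_alg:
  assumes "L < M" "M < H"
  shows "bribeproof (\<lambda>_. {L, M, H}) min_alg (linear_payment L H (lambda_M L M H) min_alg f)"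
  unfolding bribeproof_def
proof (intro ballI allI)
  fix \<theta> :: "2 \<Rightarrow> real" and i j :: 2 and x
  assume \<theta>: "\<theta> \<in> profiles (\<lambda>_. {L, M, H})" and x: "x \<in> {L, M, H}"
  let ?p = "linear_payment L H (lambda_M L M H) min_alg f"
  have p: "?p \<eta> k = min_alg \<eta> k * M + f k" for \<eta> k
    using lambda_M_combination[of L H M] assms by (simp add: linear_payment_def)
  have "\<theta> 1 \<in> {L, M, H}" "\<theta> 2 \<in> {L, M, H}"
    using \<theta> by (auto simp: mem_profiles_iff)
  then show "(i \<noteq> j \<longrightarrow> ?p \<theta> i - min_alg \<theta> i * \<theta> i + ?p \<theta> j - min_alg \<theta> j * \<theta> j
        \<ge> ?p (\<theta>(i := x)) i - min_alg (\<theta>(i := x)) i * \<theta> i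
          + ?p (\<theta>(i := x)) j - min_alg (\<theta>(i := x)) j * \<theta> j) \<and>
      (i = j \<longrightarrow> ?p \<theta> i - min_alg \<theta> i * \<theta> i
        \<ge> ?p (\<theta>(i := x)) i - min_alg (\<theta>(i := x)) i * \<theta> i)"
    using x assms exhaust_2[of i] exhaust_2[of j] unfolding p
    by (elim disjE; auto simp: min_alg_def)
qed

theorem theorem20:
  fixes L M H :: real and D :: "2 \<Rightarrow> real set"
  assumes "L < M" and "M < H"
    and D: "D = (\<lambda>i. {L, M, H})"
  shows "(\<forall>f. let p = linear_payment L H (lambda_M L M H) min_alg f in
            mechanism D min_alg p \<and> selects_min D min_alg \<and> bribeproof D min_alg p) \<and>
         (\<forall>A p. mechanism D A p \<and> selects_min D A \<and> bribeproof D A p \<longrightarrow>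
            (\<exists>f. \<forall>\<theta>\<in>profiles D. \<forall>i. p \<theta> i = f i + M * A \<theta> i))"
proof (intro conjI allI impI)
  fix f
  show "let p = linear_payment L H (lambda_M L M H) min_alg f in
      mechanism D min_alg p \<and> selects_min D min_alg \<and> bribeproof D min_alg p"
    using bribeproof_min_alg[OF assms(1,2)]
    by (simp add: Let_def D mechanism_min_alg selects_min_min_alg)
next
  fix A p
  assume "mechanism D A p \<and> selects_min D A \<and> bribeproof D A p"
  then interpret three_value_auction L M H D A p
    using assms by unfold_locales auto
  show "\<exists>f. \<forall>\<theta>\<in>profiles D. \<forall>i. p \<theta> i = f i + M * A \<theta> i"
    by (rule payment_linear)
qed

end
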